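(* Let $f:\mathbb{R}^n\to\mathbb{R}$ be a $\mathcal{C}^1$-smooth function whose gradient is globally Lipschitz continuous on $\mathbb{R}^n$ with some constant $L>0$. Let $\{x^k\}$ be the sequence generated by Algorithm DFC (described in the context) and assume that $\nabla f(x^k)\neq 0$ for all $k\in\mathbb{N}$. Then either $f(x^k)\to-\infty$ as $k\to\infty$, or the following assertions hold: (i) The sequence $\{\nabla f(x^k)\}$ converges to $0$. (ii) If $f$ satisfies the KL property at some accumulation point $\bar x$ of $\{x^k\}$, then $x^k\to\bar x$ as $k\to\infty$. (iii) If $f$ satisfies the KL property at some accumulation point $\bar x$ of $\{x^k\}$ with $\psi(t)=Mt^{q}$ for some $M>0$ and $q\in(0,1)$, then the following convergence rates are guaranteed: - If $q\in(0,1/2]$, then $\{x^k\}$, $\{\nabla f(x^k)\}$, and $\{f(x^k)\}$ converge linearly to $\bar x$, $0$, and $f(\bar x)$, respectively. - If $q\in(1/2,1)$, then, as $k\to\infty$, $\|x^k-\bar x\|=\mathcal{O}\big(k^{-\frac{1-q}{2q-1}}\big)$, $\|\nabla f(x^k)\|=\mathcal{O}\big(k^{-\frac{1-q}{2q-1}}\big)$, and $f(x^k)-f(\bar x)=\mathcal{O}\big(k^{-\frac{2-2q}{2q-1}}\big)$.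
   Context: $\|\cdot\|$ is the Euclidean norm on $\mathbb{R}^n$ and $\mathbb{N}=\{1,2,\dots\}$. Global approximation: a mapping $\mathcal{G}:\mathbb{R}^n\times(0,\infty)\to\mathbb{R}^n$ is a global approximation of $\nabla f$ if there is a constant $C>0$ such that $\|\mathcal{G}(x,\delta)-\nabla f(x)\|\le C\delta$ for all $(x,\delta)\in\mathbb{R}^n\times(0,\infty)$. Algorithm DFC. Step 0: Choose a global approximation $\mathcal{G}$ of $\nabla f$, an initial point $x^1\in\mathbb{R}^n$, an initial sampling radius $\delta_1>0$, a constant $C_1>0$, a reduction factor $\theta\in(0,1)$, and scaling factors $\mu>2$, $r>1$, $\kappa>0$. Set $k:=1$. Step 1: Find $g^k$ and the smallest nonnegative integer $i_k$ such that $g^k=\mathcal{G}(x^k,\theta^{i_k}\delta_k)$ and $\|g^k\|>\mu C_k\theta^{i_k}\delta_k$ (such $g^k,i_k$ exist whenever $\nabla f(x^k)\ne0$). Set $\delta_{k+1}:=\theta^{i_k}\delta_k$. Step 2: If $f\big(x^k-\frac{\kappa}{C_k}g^k\big)\le f(x^k)-\frac{\kappa(\mu-2)}{2C_k\mu}\|g^k\|^2$, then set $x^{k+1}:=x^k-\frac{\kappa}{C_k}g^k$ and $C_{k+1}:=C_k$. Otherwise, set $x^{k+1}:=x^k$ and $C_{k+1}:=rC_k$. Increase $k$ by $1$ and go back to Step 1. KL property: a differentiable $f:\mathbb{R}^n\to\mathbb{R}$ satisfies the KL property at $\bar x$ if there exist $\eta>0$, a neighborhood $U$ of $\bar x$,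 and a nondecreasing function $\psi:(0,\eta)\to(0,\infty)$ such that $1/\psi$ is integrable over $(0,\eta)$ and $\|\nabla f(x)\|\ge\psi\big(f(x)-f(\bar x)\big)$ for all $x\in U$ with $f(\bar x)<f(x)<f(\bar x)+\eta$. "With $\psi(t)=Mt^q$" means that this holds with that particular $\psi$ for some $\eta$ and $U$. A sequence $\{z^k\}$ converges linearly to $z$ if there are $c>0$ and $\rho\in(0,1)$ with $\|z^k-z\|\le c\rho^k$ for all sufficiently large $k$. *)

theory Defs
  imports "HOL-Analysis.Analysis" "HOL-Library.Landau_Symbols"
begin

text \<open>Meaningful only where \<open>f\<close> is differentiable.\<close>
definition gradient :: "('a::real_inner \<Rightarrow> real) \<Rightarrow> 'a \<Rightarrow> 'a" where
  "gradient f x = (THE D. GDERIV f x :> D)"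

definition C1_smooth :: "('a::real_inner \<Rightarrow> real) \<Rightarrow> bool" where
  "C1_smooth f \<longleftrightarrow> (\<forall>x. f differentiable (at x)) \<and> continuous_on UNIV (gradient f)"

text \<open>The values \<open>G x \<delta>\<close> with \<open>\<delta> \<le> 0\<close> are irrelevant: the domain is
  \<open>\<real>\<^sup>n \<times> (0,\<infinity>)\<close>.\<close>
definition global_approximation ::
  "('a::real_inner \<Rightarrow> real \<Rightarrow> 'a) \<Rightarrow> ('a \<Rightarrow> real) \<Rightarrow> bool" where
  "global_approximation G f \<longleftrightarrow>
     (\<exists>K>0. \<forall>x. \<forall>\<delta>>0. norm (G x \<delta> - gradient f x) \<le> K * \<delta>)"

text \<open>\<open>DFC_run f G \<theta> \<mu> r \<kappa> x g i \<delta> C\<close> says that \<open>x, g, i, \<delta>, C\<close> are the sequences of an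
  infinite run of Algorithm DFC. Iterations are numbered from 1, so entries with index 0 are
  unconstrained. The initial data are \<open>x 1\<close>, \<open>\<delta> 1\<close> and \<open>C 1\<close>.\<close>
definition DFC_run ::
  "('a::real_inner \<Rightarrow> real) \<Rightarrow> ('a \<Rightarrow> real \<Rightarrow> 'a) \<Rightarrow> real \<Rightarrow> real \<Rightarrow> real \<Rightarrow> real \<Rightarrow>
   (nat \<Rightarrow> 'a) \<Rightarrow> (nat \<Rightarrow> 'a) \<Rightarrow> (nat \<Rightarrow> nat) \<Rightarrow> (nat \<Rightarrow> real) \<Rightarrow> (nat \<Rightarrow> real) \<Rightarrow> bool" where
  "DFC_run f G \<theta> \<mu> r \<kappa> x g i \<delta> C \<longleftrightarrow>
     global_approximation G f \<and> \<delta> 1 > 0 \<and> C 1 > 0 \<and>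
     0 < \<theta> \<and> \<theta> < 1 \<and> \<mu> > 2 \<and> r > 1 \<and> \<kappa> > 0 \<and>
     (\<forall>k\<ge>1.
        g k = G (x k) (\<theta> ^ i k * \<delta> k) \<and>
        norm (g k) > \<mu> * C k * \<theta> ^ i k * \<delta> k \<and>
        (\<forall>j<i k. \<not> norm (G (x k) (\<theta> ^ j * \<delta> k)) > \<mu> * C k * \<theta> ^ j * \<delta> k) \<and>
        \<delta> (k + 1) = \<theta> ^ i k * \<delta> k \<and>
        (if f (x k - (\<kappa> / C k) *\<^sub>R g k)
              \<le> f (x k) - \<kappa> * (\<mu> - 2) / (2 * C k * \<mu>) * (norm (g k))\<^sup>2
         then x (k + 1) = x k - (\<kappa> / C k) *\<^sub>R g k \<and> C (k + 1) = C k
         else x (k + 1) = x k \<and> C (k + 1) = r * C k))"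

definition KL_property_with ::
  "('a::real_inner \<Rightarrow> real) \<Rightarrow> 'a \<Rightarrow> (real \<Rightarrow> real) \<Rightarrow> bool" where
  "KL_property_with f xbar \<psi> \<longleftrightarrow>
     (\<exists>\<eta>>0. \<exists>U. xbar \<in> interior U \<and>
        mono_on {0<..<\<eta>} \<psi> \<and> (\<forall>t\<in>{0<..<\<eta>}. \<psi> t > 0) \<and>
        set_integrable lborel {0<..<\<eta>} (\<lambda>t. 1 / \<psi> t) \<and>
        (\<forall>x\<in>U. f xbar < f x \<and> f x < f xbar + \<eta> \<longrightarrow>
           norm (gradient f x) \<ge> \<psi> (f x - f xbar)))"

definition KL_property :: "('a::real_inner \<Rightarrow> real) \<Rightarrow> 'a \<Rightarrow> bool" where
  "KL_property f xbar \<longleftrightarrow> (\<exists>\<psi>. KL_property_with f xbar \<psi>)"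

definition accumulation_point :: "(nat \<Rightarrow> 'a::topological_space) \<Rightarrow> 'a \<Rightarrow> bool" where
  "accumulation_point z l \<longleftrightarrow> (\<exists>s. strict_mono s \<and> (z \<circ> s) \<longlonglongrightarrow> l)"

definition converges_linearly :: "(nat \<Rightarrow> 'a::real_normed_vector) \<Rightarrow> 'a \<Rightarrow> bool" where
  "converges_linearly z l \<longleftrightarrow>
     (\<exists>c>0. \<exists>\<rho>\<in>{0<..<1}. \<forall>\<^sub>F k in sequentially. norm (z k - l) \<le> c * \<rho> ^ k)"

end

theory Submission
  imports Defs
begin

text \<open>
  Why the theorem holds. The parameter \<open>C\<close> plays the role of an estimate of the unknown constants
  \<open>L\<close> and \<open>K\<close> (the error constant of \<open>G\<close>). The acceptance test of Step 1 makes the error of \<open>g k\<close>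
  relative, \<open>norm (g k - \<nabla>f (x k)) \<le> K / (\<mu> C k) * norm (g k)\<close>, so by the descent lemma the test of
  Step 2 succeeds as soon as \<open>C k \<ge> max K (\<kappa> L)\<close>. Every failure multiplies \<open>C\<close> by \<open>r > 1\<close>, hence
  there are only finitely many failures. From some index on the method is thus a descent method
  with constant step size, and each step decreases \<open>f\<close> by at least a constant multiple of
  \<open>(norm (\<nabla>f (x k)))\<^sup>2\<close> and of \<open>norm (\<nabla>f (x k)) * norm (x (k + 1) - x k)\<close>
  (\<open>DFC_eventual_descent\<close>). The convergence analysis rests on these two bounds.

  If \<open>f (x k)\<close> does not tend to \<open>-\<infinity>\<close>, it converges, and the first bound gives
  \<open>\<nabla>f (x k) \<longlonglongrightarrow> 0\<close>. For the convergence of the iterates, let \<open>s k = f (x k) - f xbar\<close> and let \<open>\<phi>\<close> be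
  an antiderivative of \<open>1/\<psi>\<close> with \<open>\<phi>(0+) = 0\<close>. While \<open>x k\<close> stays in the KL neighbourhood, the
  second bound gives \<open>norm (x (k + 1) - x k) \<le> (\<phi> (s k) - \<phi> (s (k + 1))) / \<sigma>\<close>; this telescopes, so
  the path has finite length, cannot leave the neighbourhood once \<open>x k\<close> is close enough to \<open>xbar\<close>,
  and satisfies \<open>norm (x k - xbar) \<le> \<phi> (s k) / \<sigma>\<close>
  (\<open>descent_path_tendsto\<close>, \<open>descent_path_tail_bound\<close>).

  For \<open>\<psi> t = M t\<^sup>q\<close> one has \<open>\<phi> s = s powr (1 - q) / (M (1 - q))\<close>, so all rates reduce to one for
  \<open>s\<close>. The first bound and the KL inequality give \<open>s (k + 1) \<le> s k - c * s k powr (2 q)\<close>. For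
  \<open>q \<le> 1/2\<close> this forces geometric decay; for \<open>q > 1/2\<close> convexity shows that
  \<open>s k powr (1 - 2 q)\<close> grows at least linearly, so \<open>s k = O(k powr (- 1 / (2 q - 1)))\<close>. The
  gradient inherits the rate of \<open>x\<close> through the Lipschitz condition, since \<open>\<nabla>f xbar = 0\<close>.
\<close>


section \<open>Gradients and the descent lemma\<close>

text \<open>In finite dimension the derivative is represented by the vector of its values on an
  orthonormal basis, so the definite description in \<^const>\<open>gradient\<close> is meaningful.\<close>

lemma gderiv_gradient:
  fixes f :: "'a::euclidean_space \<Rightarrow> real"
  assumes "f differentiable (at x)"
  shows "GDERIV f x :> gradient f x"
proof -
  obtain f' where f': "(f has_derivative f') (at x)"
    using assms by (auto simp: differentiable_def)
  interpret linear f' using f' by (rule has_derivative_linear)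
  define D where "D = (\<Sum>b\<in>Basis. f' b *\<^sub>R b)"
  have "f' h = h \<bullet> D" for h
  proof -
    have "f' h = f' (\<Sum>b\<in>Basis. (h \<bullet> b) *\<^sub>R b)" by (simp add: euclidean_representation)
    also have "\<dots> = (\<Sum>b\<in>Basis. (h \<bullet> b) * f' b)" by (simp add: sum scale)
    also have "\<dots> = h \<bullet> D" by (simp add: D_def inner_sum_right mult.commute)
    finally show ?thesis .
  qed
  then have "f' = (\<lambda>h. h \<bullet> D)" by blast
  then have D: "GDERIV f x :> D" using f' by (simp add: gderiv_def)
  show ?thesis
    unfolding gradient_def
  proof (rule theI[where P = "\<lambda>D. GDERIV f x :> D" and a = D])
    show "GDERIV f x :> D" by (rule D)
    fix E assume "GDERIV f x :> E"
    then have "(\<lambda>h. h \<bullet> E) = (\<lambda>h. h \<bullet> D)"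
      using D unfolding gderiv_def by (rule has_derivative_unique)
    then show "E = D" by (metis vector_eq_ldot)
  qed
qed

text \<open>Along the segment from \<open>x\<close> to \<open>x + h\<close> the slope of \<open>f\<close> exceeds its initial value by at most
  \<open>L * t * (norm h)\<^sup>2\<close>; subtracting an antiderivative of this bound leaves a nonincreasing
  function.\<close>

lemma descent_lemma:
  fixes f :: "'a::euclidean_space \<Rightarrow> real"
  assumes diff: "\<And>x. f differentiable (at x)"
    and lip: "L-lipschitz_on UNIV (gradient f)"
  shows "f (x + h) \<le> f x + h \<bullet> gradient f x + L / 2 * (norm h)\<^sup>2"
proof -
  define p where "p t = f (x + t *\<^sub>R h) - t * (h \<bullet> gradient f x) - L / 2 * t\<^sup>2 * (norm h)\<^sup>2" for t
  have "p 1 \<le> p 0"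
  proof (rule DERIV_nonpos_imp_nonincreasing[where f = p])
    fix t :: real assume t: "0 \<le> t" "t \<le> 1"
    define D where "D = h \<bullet> gradient f (x + t *\<^sub>R h) - h \<bullet> gradient f x - L * t * (norm h)\<^sup>2"
    have "((\<lambda>t. f (x + t *\<^sub>R h)) has_derivative (\<lambda>u. (u *\<^sub>R h) \<bullet> gradient f (x + t *\<^sub>R h))) (at t)"
    proof (rule has_derivative_compose[of "\<lambda>t. x + t *\<^sub>R h"])
      show "((\<lambda>t. x + t *\<^sub>R h) has_derivative (\<lambda>u. u *\<^sub>R h)) (at t)"
        by (auto intro!: derivative_eq_intros)
      show "(f has_derivative (\<lambda>k. k \<bullet> gradient f (x + t *\<^sub>R h))) (at (x + t *\<^sub>R h))"
        using gderiv_gradient[OF diff] by (simp add: gderiv_def)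
    qed
    then have 1: "((\<lambda>t. f (x + t *\<^sub>R h)) has_real_derivative h \<bullet> gradient f (x + t *\<^sub>R h)) (at t)"
      by (simp add: has_field_derivative_def mult_commute_abs)
    have "(p has_real_derivative D) (at t)"
      unfolding p_def D_def by (rule derivative_eq_intros 1 refl | simp)+
    moreover have "D \<le> 0"
    proof -
      have "norm (gradient f (x + t *\<^sub>R h) - gradient f x) \<le> L * (t * norm h)"
        using lipschitz_onD[OF lip, of "x + t *\<^sub>R h" x] t by (simp add: dist_norm)
      then have "norm h * norm (gradient f (x + t *\<^sub>R h) - gradient f x)
          \<le> norm h * (L * (t * norm h))"
        by (intro mult_left_mono) auto
      then have "h \<bullet> (gradient f (x + t *\<^sub>R h) - gradient f x) \<le> norm h * (L * (t * norm h))"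
        using norm_cauchy_schwarz order_trans by blast
      then show ?thesis by (simp add: D_def inner_diff_right power2_eq_square algebra_simps)
    qed
    ultimately show "\<exists>y. (p has_real_derivative y) (at t) \<and> y \<le> 0" by blast
  qed simp
  then show ?thesis by (simp add: p_def)
qed


section \<open>Eventual descent of the algorithm\<close>

text \<open>The bounds \<open>C \<ge> K\<close> and \<open>C \<ge> \<kappa> * L\<close> serve different ends: the first turns the relative
  error of \<open>g\<close> into \<open>1 / \<mu>\<close>, so that \<open>g \<bullet> \<nabla>f x \<ge> (1 - 1 / \<mu>) * (norm g)\<^sup>2\<close>, and the second bounds
  the quadratic term of the descent lemma by half of \<open>\<kappa> / C * (norm g)\<^sup>2\<close>. The difference
  \<open>1 - 1 / \<mu> - 1 / 2\<close> is the factor in the test.\<close>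

lemma sufficient_decrease_if_large_parameter:
  fixes f :: "'a::euclidean_space \<Rightarrow> real"
  assumes diff: "\<And>x. f differentiable (at x)"
    and lip: "L-lipschitz_on UNIV (gradient f)"
    and err: "norm (g - gradient f x) \<le> K * d" and acc: "norm g > \<mu> * C * d"
    and d: "d \<ge> 0" and \<mu>: "\<mu> > 0" and C: "C > 0" "K \<le> C" "\<kappa> * L \<le> C" and \<kappa>: "\<kappa> > 0"
  shows "f (x - (\<kappa> / C) *\<^sub>R g) \<le> f x - \<kappa> * (\<mu> - 2) / (2 * C * \<mu>) * (norm g)\<^sup>2"
proof -
  define t where "t = \<kappa> / C"
  have t: "t > 0" "t * L \<le> 1" using C \<kappa> by (auto simp: t_def divide_simps)
  have "norm (g - gradient f x) \<le> C * d"
    using err mult_right_mono[OF C(2) d] by linarith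
  also have "\<dots> \<le> norm g / \<mu>" using acc \<mu> by (simp add: field_simps)
  finally have err': "norm (g - gradient f x) \<le> norm g / \<mu>" .
  have "g \<bullet> (g - gradient f x) \<le> norm g * (norm g / \<mu>)"
    using norm_cauchy_schwarz[of g "g - gradient f x"] mult_left_mono[OF err' norm_ge_zero[of g]]
    by linarith
  then have ip: "g \<bullet> gradient f x \<ge> (1 - 1 / \<mu>) * (norm g)\<^sup>2"
    by (simp add: inner_diff_right power2_norm_eq_inner[symmetric] power2_eq_square algebra_simps)
  have "f (x - t *\<^sub>R g) \<le> f x - t * (g \<bullet> gradient f x) + L / 2 * (t\<^sup>2 * (norm g)\<^sup>2)"
    using descent_lemma[OF diff lip, of x "- (t *\<^sub>R g)"] t(1) by (simp add: power_mult_distrib)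
  also have "\<dots> \<le> f x - t * ((1 - 1 / \<mu>) * (norm g)\<^sup>2) + t / 2 * (norm g)\<^sup>2"
  proof -
    have "t * ((1 - 1 / \<mu>) * (norm g)\<^sup>2) \<le> t * (g \<bullet> gradient f x)"
      using ip t by (intro mult_left_mono) auto
    moreover have "(t * L) * (t * (norm g)\<^sup>2) \<le> 1 * (t * (norm g)\<^sup>2)"
      using t by (intro mult_right_mono) auto
    ultimately show ?thesis by (simp add: power2_eq_square algebra_simps)
  qed
  also have "\<dots> = f x - \<kappa> * (\<mu> - 2) / (2 * C * \<mu>) * (norm g)\<^sup>2"
    using \<mu> C by (simp add: t_def field_simps)
  finally show ?thesis by (simp add: t_def)
qed

text \<open>\<open>C\<close> is nondecreasing, and bounded because it grows only while it is below \<open>B\<close>. A bounded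
  monotone sequence has increments tending to \<open>0\<close>, whereas a multiplication by \<open>r\<close> increases \<open>C\<close> by
  at least \<open>(r - 1) * C 1\<close>.\<close>

lemma eventually_constant_if_bounded_growth:
  fixes C :: "nat \<Rightarrow> real"
  assumes C1: "C 1 > 0" and r: "r > 1"
    and step: "\<And>k. k \<ge> 1 \<Longrightarrow> C (k + 1) = C k \<or> C (k + 1) = r * C k \<and> C k < B"
  shows "\<exists>N\<ge>1. \<forall>k\<ge>N. C (k + 1) = C k"
proof -
  have ge: "C k \<ge> C 1" if "k \<ge> 1" for k
    using that
  proof (induction k rule: nat_induct_at_least)
    case (Suc n)
    then have "C n \<le> r * C n" using C1 r by (simp add: mult_le_cancel_right1)
    then show ?case using step[of n] Suc by auto
  qed simp
  have mono: "C k \<le> C (k + 1)" if "k \<ge> 1" for k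
    using step[OF that] ge[OF that] C1 r by (auto simp: mult_le_cancel_right1)
  have le: "C k \<le> max (C 1) (r * B)" if "k \<ge> 1" for k
    using that
  proof (induction k rule: nat_induct_at_least)
    case (Suc n)
    show ?case
    proof (cases "C (n + 1) = C n")
      case False
      then have "C (n + 1) = r * C n" "C n < B" using step[of n] Suc.hyps by auto
      then have "C (n + 1) \<le> r * B" using r by simp
      then show ?thesis by simp
    qed (use Suc in simp)
  qed simp
  have "incseq (\<lambda>k. C (Suc k))" using mono by (intro incseq_SucI) simp
  then obtain l where l: "(\<lambda>k. C (Suc k)) \<longlonglongrightarrow> l"
    by (rule incseq_convergent[where B = "max (C 1) (r * B)"]) (use le in auto)
  have "(\<lambda>k. C (Suc (Suc k)) - C (Suc k)) \<longlonglongrightarrow> l - l"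
    by (intro tendsto_diff l LIMSEQ_Suc)
  then have "\<forall>\<^sub>F k in sequentially. C (Suc (Suc k)) - C (Suc k) < (r - 1) * C 1"
    using C1 r by (intro order_tendstoD(2)[where y = "l - l"]) auto
  then obtain N where N: "\<And>k. k \<ge> N \<Longrightarrow> C (Suc (Suc k)) - C (Suc k) < (r - 1) * C 1"
    by (auto simp: eventually_sequentially)
  have "C (k + 1) = C k" if "k \<ge> Suc N" for k
  proof (rule ccontr)
    assume "C (k + 1) \<noteq> C k"
    then have "C (k + 1) - C k = (r - 1) * C k" using step[of k] that by (auto simp: algebra_simps)
    also have "\<dots> \<ge> (r - 1) * C 1" using ge[of k] that r by (intro mult_left_mono) auto
    finally have "(r - 1) * C 1 \<le> C (k + 1) - C k" .
    moreover obtain j where "k = Suc j" using \<open>Suc N \<le> k\<close> by (cases k) auto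
    moreover have "N \<le> j" using that \<open>k = Suc j\<close> by simp
    ultimately show False using N[of j] by simp
  qed
  then show ?thesis by (intro exI[of _ "Suc N"]) auto
qed

text \<open>Once \<open>C\<close> is constant, every step passes the test of Step 2. Both bounds come
  from the decrease \<open>a * (norm (g k))\<^sup>2\<close>: the true gradient is at most a constant multiple of
  \<open>g k\<close>, and the step is exactly a constant multiple of it.\<close>

lemma DFC_eventual_descent:
  fixes f :: "'a::euclidean_space \<Rightarrow> real"
  assumes diff: "\<And>x. f differentiable (at x)"
    and lip: "L-lipschitz_on UNIV (gradient f)"
    and run: "DFC_run f G \<theta> \<mu> r \<kappa> x g i \<delta> C"
  obtains N a \<sigma> where "N \<ge> 1" "a > 0" "\<sigma> > 0"
    "\<And>k. k \<ge> N \<Longrightarrow> a * (norm (gradient f (x k)))\<^sup>2 \<le> f (x k) - f (x (Suc k))"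
    "\<And>k. k \<ge> N \<Longrightarrow>
       \<sigma> * norm (gradient f (x k)) * norm (x (Suc k) - x k) \<le> f (x k) - f (x (Suc k))"
proof -
  have par: "\<delta> 1 > 0" "C 1 > 0" "0 < \<theta>" "\<theta> < 1" "\<mu> > 2" "r > 1" "\<kappa> > 0"
    using run by (auto simp: DFC_run_def)
  obtain K where K: "K > 0" "\<And>x d. d > 0 \<Longrightarrow> norm (G x d - gradient f x) \<le> K * d"
    using run by (auto simp: DFC_run_def global_approximation_def)
  have step: "g k = G (x k) (\<delta> (k + 1))" "norm (g k) > \<mu> * C k * \<delta> (k + 1)"
      "\<delta> (k + 1) = \<theta> ^ i k * \<delta> k"
      "if f (x k - (\<kappa> / C k) *\<^sub>R g k) \<le> f (x k) - \<kappa> * (\<mu> - 2) / (2 * C k * \<mu>) * (norm (g k))\<^sup>2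
       then x (k + 1) = x k - (\<kappa> / C k) *\<^sub>R g k \<and> C (k + 1) = C k
       else x (k + 1) = x k \<and> C (k + 1) = r * C k" if "k \<ge> 1" for k
    using run that unfolding DFC_run_def by (auto simp: mult.assoc)
  have \<delta>: "\<delta> k > 0" if "k \<ge> 1" for k
    using that by (induction k rule: nat_induct_at_least) (use par step(3) in auto)
  have C: "C k > 0" if "k \<ge> 1" for k
    using that
  proof (induction k rule: nat_induct_at_least)
    case (Suc n)
    then show ?case using step(4)[of n] par by (auto split: if_splits)
  qed (use par in simp)
  have err: "norm (g k - gradient f (x k)) \<le> K * \<delta> (k + 1)" if "k \<ge> 1" for k
    using K(2) \<delta>[of "k + 1"] step(1)[OF that] by simp
  have "\<exists>N\<ge>1. \<forall>k\<ge>N. C (k + 1) = C k"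
  proof (rule eventually_constant_if_bounded_growth[where r = r and B = "max K (\<kappa> * L)"])
    fix k :: nat assume k: "k \<ge> 1"
    show "C (k + 1) = C k \<or> C (k + 1) = r * C k \<and> C k < max K (\<kappa> * L)"
    proof (cases "C k < max K (\<kappa> * L)")
      case True
      then show ?thesis using step(4)[OF k] by (auto split: if_splits)
    next
      case False
      then have "f (x k - (\<kappa> / C k) *\<^sub>R g k)
          \<le> f (x k) - \<kappa> * (\<mu> - 2) / (2 * C k * \<mu>) * (norm (g k))\<^sup>2"
        using sufficient_decrease_if_large_parameter[OF diff lip err[OF k] step(2)[OF k]]
          \<delta>[of "k + 1"] C[OF k] par by simp
      then show ?thesis using step(4)[OF k] by auto
    qed
  qed (use par in auto)
  then obtain N where N: "N \<ge> 1" "\<And>k. k \<ge> N \<Longrightarrow> C (k + 1) = C k" by blast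
  define c where "c = C N"
  have c: "c > 0" using C N by (simp add: c_def)
  have Cc: "C k = c" if "k \<ge> N" for k
    using that by (induction k rule: nat_induct_at_least) (use N c_def in auto)
  define a where "a = \<kappa> * (\<mu> - 2) / (2 * c * \<mu>)"
  define b where "b = 1 + K / (\<mu> * c)"
  define t where "t = \<kappa> / c"
  have pos: "a > 0" "b > 0" "t > 0" using par c K by (auto simp: a_def b_def t_def add_pos_pos)
  have succ: "x (Suc k) = x k - t *\<^sub>R g k \<and> a * (norm (g k))\<^sup>2 \<le> f (x k) - f (x (Suc k))"
    if "k \<ge> N" for k
  proof -
    have "C (k + 1) \<noteq> r * C k" using N(2)[OF that] C[of k] par N(1) that by simp
    then show ?thesis
      using step(4)[of k] N(1) that Cc[OF that]
      by (auto simp: t_def a_def split: if_splits)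
  qed
  have grad: "norm (gradient f (x k)) \<le> b * norm (g k)" if "k \<ge> N" for k
  proof -
    have k: "k \<ge> 1" using that N by simp
    have "\<delta> (k + 1) \<le> norm (g k) / (\<mu> * c)"
      using step(2)[OF k] Cc[OF that] par c by (simp add: field_simps)
    then have "K * \<delta> (k + 1) \<le> K * (norm (g k) / (\<mu> * c))"
      using K by (intro mult_left_mono) auto
    then have "norm (g k - gradient f (x k)) \<le> K / (\<mu> * c) * norm (g k)"
      using err[OF k] by simp
    moreover have "norm (gradient f (x k)) \<le> norm (g k) + norm (g k - gradient f (x k))"
      by (metis norm_minus_commute norm_triangle_sub)
    ultimately show ?thesis by (simp add: b_def algebra_simps)
  qed
  show ?thesis
  proof (rule that[of N "a / b\<^sup>2" "a / (b * t)"])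
    fix k assume k: "k \<ge> N"
    have "(norm (gradient f (x k)))\<^sup>2 \<le> (b * norm (g k))\<^sup>2"
      using grad[OF k] by (intro power_mono) auto
    then have "a / b\<^sup>2 * (norm (gradient f (x k)))\<^sup>2 \<le> a / b\<^sup>2 * (b * norm (g k))\<^sup>2"
      using pos by (intro mult_left_mono) auto
    also have "\<dots> = a * (norm (g k))\<^sup>2" using pos by (simp add: power_mult_distrib)
    finally show "a / b\<^sup>2 * (norm (gradient f (x k)))\<^sup>2 \<le> f (x k) - f (x (Suc k))"
      using succ[OF k] by linarith
    have "a / (b * t) * norm (gradient f (x k)) * norm (x (Suc k) - x k)
        = a / b * norm (gradient f (x k)) * norm (g k)"
      using succ[OF k] pos by simp
    also have "\<dots> \<le> a / b * (b * norm (g k)) * norm (g k)"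
      using grad[OF k] pos by (intro mult_right_mono mult_left_mono) auto
    also have "\<dots> = a * (norm (g k))\<^sup>2" using pos by (simp add: power2_eq_square)
    finally show "a / (b * t) * norm (gradient f (x k)) * norm (x (Suc k) - x k)
        \<le> f (x k) - f (x (Suc k))"
      using succ[OF k] by linarith
  qed (use N pos in auto)
qed


section \<open>Desingularizing functions\<close>

text \<open>The inequality says that \<open>\<phi>\<close> has slope at least \<open>1 / \<psi> s\<close> to the left of \<open>s\<close>. It replaces
  \<open>\<phi>' = 1 / \<psi>\<close>, which may fail where the monotone function \<open>\<psi>\<close> jumps, and it suffices
  for the telescoping argument.\<close>

definition desingularizing :: "(real \<Rightarrow> real) \<Rightarrow> (real \<Rightarrow> real) \<Rightarrow> real \<Rightarrow> bool" where
  "desingularizing \<phi> \<psi> \<eta> \<longleftrightarrow>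
     (\<forall>s\<in>{0<..<\<eta>}. 0 < \<psi> s \<and> 0 \<le> \<phi> s) \<and> (\<phi> \<longlongrightarrow> 0) (at_right 0) \<and>
     (\<forall>s\<in>{0<..<\<eta>}. \<forall>s'\<in>{0<..s}. s - s' \<le> \<psi> s * (\<phi> s - \<phi> s'))"

text \<open>As \<open>1 / \<psi>\<close> is nonincreasing, its integral over \<open>{s'..s}\<close> is at least \<open>(s - s') / \<psi> s\<close>, and
  integrability near \<open>0\<close> makes the indefinite integral tend to \<open>0\<close> there.\<close>

lemma desingularizing_integral:
  assumes \<eta>: "\<eta> > 0" and mono: "mono_on {0<..<\<eta>} \<psi>" and pos: "\<And>t. t \<in> {0<..<\<eta>} \<Longrightarrow> \<psi> t > 0"
    and int: "set_integrable lborel {0<..<\<eta>} (\<lambda>t. 1 / \<psi> t)"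
  shows "\<exists>\<phi>. desingularizing \<phi> \<psi> \<eta>"
proof -
  \<comment> \<open>Cutting off by the indicator makes the integrand nonnegative at \<open>0\<close> as well, where \<open>\<psi>\<close> is
    arbitrary.\<close>
  define h where "h t = indicat_real {0<..<\<eta>} t * (1 / \<psi> t)" for t
  define \<phi> where "\<phi> s = integral {0..s} h" for s
  have h0: "h t \<ge> 0" for t
    using pos[of t] by (auto simp: h_def indicator_def)
  have "h integrable_on UNIV"
    using int unfolding set_integrable_def h_def by (auto intro!: integrable_on_lborel)
  then have hint: "h integrable_on {u..v}" for u v
    using integrable_on_subcbox[of h UNIV u v] by simp
  have "continuous_on {0..\<eta>} \<phi>"
    unfolding \<phi>_def by (rule indefinite_integral_continuous_1[OF hint])
  then have "(\<phi> \<longlongrightarrow> \<phi> 0) (at 0 within {0..\<eta>})"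
    using \<eta> by (auto simp: continuous_on_def)
  then have lim: "(\<phi> \<longlongrightarrow> 0) (at_right 0)"
    using \<eta> by (simp add: at_within_Icc_at_right \<phi>_def)
  have "s - s' \<le> \<psi> s * (\<phi> s - \<phi> s')" if s: "s \<in> {0<..<\<eta>}" "s' \<in> {0<..s}" for s s'
  proof -
    have "(s - s') * (1 / \<psi> s) = integral {s'..s} (\<lambda>_. 1 / \<psi> s)" using s by simp
    also have "\<dots> \<le> integral {s'..s} h"
    proof (rule integral_le)
      fix t assume t: "t \<in> {s'..s}"
      then have "\<psi> t \<le> \<psi> s" using s by (intro mono_onD[OF mono]) auto
      then show "1 / \<psi> s \<le> h t" using t s pos[of t] by (auto simp: h_def intro!: divide_left_mono)
    qed (use hint in auto)
    also have "\<dots> = \<phi> s - \<phi> s'"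
      using Henstock_Kurzweil_Integration.integral_combine[of 0 s' s h] hint s by (simp add: \<phi>_def)
    finally show ?thesis using pos[OF s(1)] by (simp add: field_simps)
  qed
  moreover have "\<phi> s \<ge> 0" for s
    unfolding \<phi>_def by (rule integral_nonneg[OF hint]) (use h0 in auto)
  ultimately show ?thesis using lim pos unfolding desingularizing_def by blast
qed

text \<open>After multiplication by \<open>1 - q\<close> the slope inequality is Young's inequality
  \<open>s powr q * s' powr (1 - q) \<le> q * s + (1 - q) * s'\<close>.\<close>

lemma desingularizing_powr:
  assumes M: "M > 0" and q: "0 < q" "q < (1::real)"
  shows "desingularizing (\<lambda>s. s powr (1 - q) / (M * (1 - q))) (\<lambda>t. M * t powr q) \<eta>"
proof -
  have "((\<lambda>s::real. s powr (1 - q) / (M * (1 - q))) \<longlongrightarrow> 0 powr (1 - q) / (M * (1 - q))) (at_right 0)"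
    using q by (intro tendsto_divide tendsto_powr' tendsto_const tendsto_ident_at)
      (auto simp: eventually_at_filter M less_imp_neq[symmetric])
  moreover have "s - s' \<le> M * s powr q * (s powr (1 - q) / (M * (1 - q)) - s' powr (1 - q) / (M * (1 - q)))"
    if s: "0 < s" "0 < s'" for s s'
  proof -
    have "s powr q * s' powr (1 - q) \<le> q * s + (1 - q) * s'"
      using s q by (intro Youngs_inequality_0) auto
    moreover have "s powr q * s powr (1 - q) = s"
      using s by (simp add: powr_add[symmetric])
    ultimately have "(1 - q) * (s - s') \<le> s powr q * (s powr (1 - q) - s' powr (1 - q))"
      by (simp add: algebra_simps)
    then have "s - s' \<le> s powr q * (s powr (1 - q) - s' powr (1 - q)) / (1 - q)"
      using q by (simp add: field_simps)
    also have "\<dots> = M * s powr q * (s powr (1 - q) / (M * (1 - q)) - s' powr (1 - q) / (M * (1 - q)))"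
      using M by (simp add: diff_divide_distrib[symmetric])
    finally show ?thesis .
  qed
  ultimately show ?thesis using M q by (auto simp: desingularizing_def)
qed


section \<open>Paths of finite length\<close>

text \<open>In the following lemmas \<open>s\<close> stands for the gaps \<open>f (z n) - f xbar\<close> and \<open>w\<close> for the gradient
  norms along a descent path \<open>z\<close>. Combining descent with \<open>\<psi> (s n) \<le> w n\<close> and the slope inequality
  for \<open>\<phi>\<close> lets \<open>\<psi> (s n)\<close> cancel, and the resulting bounds on the steps telescope.\<close>

lemma descent_path_length:
  fixes z :: "nat \<Rightarrow> 'a::real_normed_vector"
  assumes des: "desingularizing \<phi> \<psi> \<eta>" and \<sigma>: "\<sigma> > 0"
    and descent: "\<And>n. k \<le> n \<Longrightarrow> \<sigma> * w n * norm (z (Suc n) - z n) \<le> s n - s (Suc n)"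
    and pos: "\<And>n. k \<le> n \<Longrightarrow> 0 < s n"
    and KL: "\<And>n. k \<le> n \<Longrightarrow> n < j \<Longrightarrow> s n < \<eta> \<and> \<psi> (s n) \<le> w n"
    and "k \<le> j"
  shows "\<sigma> * norm (z j - z k) \<le> \<phi> (s k) - \<phi> (s j)"
  using \<open>k \<le> j\<close> KL
proof (induction j rule: dec_induct)
  case (step n)
  have n: "s n < \<eta>" "\<psi> (s n) \<le> w n" "0 < s n" "0 < s (Suc n)"
    using step pos[of n] pos[of "Suc n"] by auto
  have \<psi>: "0 < \<psi> (s n)" using des n by (auto simp: desingularizing_def)
  have "\<psi> (s n) * (\<sigma> * norm (z (Suc n) - z n)) \<le> w n * (\<sigma> * norm (z (Suc n) - z n))"
    using n \<sigma> by (intro mult_right_mono) auto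
  also have "\<dots> \<le> s n - s (Suc n)" using descent[of n] step by (simp add: mult_ac)
  finally have 1: "\<psi> (s n) * (\<sigma> * norm (z (Suc n) - z n)) \<le> s n - s (Suc n)" .
  then have "s (Suc n) \<le> s n" using \<psi> \<sigma> zero_le_mult_iff norm_ge_zero
    by (smt (verit) mult_nonneg_nonneg)
  then have "s n - s (Suc n) \<le> \<psi> (s n) * (\<phi> (s n) - \<phi> (s (Suc n)))"
    using des n by (auto simp: desingularizing_def)
  with 1 \<psi> have "\<sigma> * norm (z (Suc n) - z n) \<le> \<phi> (s n) - \<phi> (s (Suc n))"
    by (meson mult_le_cancel_left_pos order_trans)
  moreover have "norm (z (Suc n) - z k) \<le> norm (z (Suc n) - z n) + norm (z n - z k)"
    using norm_triangle_ineq[of "z (Suc n) - z n" "z n - z k"] by simp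
  then have "\<sigma> * norm (z (Suc n) - z k) \<le> \<sigma> * norm (z (Suc n) - z n) + \<sigma> * norm (z n - z k)"
    using \<sigma> by (simp add: distrib_left[symmetric])
  moreover have "\<sigma> * norm (z n - z k) \<le> \<phi> (s k) - \<phi> (s n)" using step by simp
  ultimately show ?case by linarith
qed simp

text \<open>Near \<open>xbar\<close> the remaining length \<open>\<phi> (s k) / \<sigma>\<close> is smaller than the distance to the boundary of
  the KL neighbourhood, so by induction the path never leaves it. As the neighbourhood may be
  shrunk at will, this gives convergence.\<close>

lemma descent_path_tendsto:
  fixes z :: "nat \<Rightarrow> 'a::real_normed_vector"
  assumes des: "desingularizing \<phi> \<psi> \<eta>" and \<eta>: "\<eta> > 0" and \<sigma>: "\<sigma> > 0"
    and descent: "\<And>n. N \<le> n \<Longrightarrow> \<sigma> * w n * norm (z (Suc n) - z n) \<le> s n - s (Suc n)"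
    and pos: "\<And>n. N \<le> n \<Longrightarrow> 0 < s n" and lim: "s \<longlonglongrightarrow> 0"
    and KL: "\<And>n. N \<le> n \<Longrightarrow> z n \<in> U \<Longrightarrow> s n < \<eta> \<Longrightarrow> \<psi> (s n) \<le> w n"
    and U: "xbar \<in> interior U" and acc: "accumulation_point z xbar"
  shows "z \<longlonglongrightarrow> xbar"
proof (rule LIMSEQ_I)
  fix e :: real assume "e > 0"
  obtain d where "d > 0" "ball xbar d \<subseteq> U" using U by (auto simp: mem_interior)
  then obtain \<epsilon> where \<epsilon>: "\<epsilon> > 0" "\<epsilon> \<le> e" "ball xbar \<epsilon> \<subseteq> U"
    using \<open>e > 0\<close> that[of "min d e"] subset_ball[of "min d e" d xbar] by auto
  have "filterlim s (at_right 0) sequentially"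
    using lim pos by (intro tendsto_imp_filterlim_at_right) (auto intro: eventually_sequentiallyI)
  moreover have "(\<phi> \<longlongrightarrow> 0) (at_right 0)" using des by (simp add: desingularizing_def)
  ultimately have \<phi>0: "(\<lambda>n. \<phi> (s n)) \<longlonglongrightarrow> 0" by (rule filterlim_compose[rotated])
  have "\<forall>\<^sub>F n in sequentially. N \<le> n \<and> s n < \<eta> \<and> \<phi> (s n) < \<sigma> * (\<epsilon> / 2)"
    using order_tendstoD(2)[OF lim \<eta>] order_tendstoD(2)[OF \<phi>0, of "\<sigma> * (\<epsilon> / 2)"] \<sigma> \<epsilon>
    by (auto intro!: eventually_conj eventually_ge_at_top)
  then obtain n0 where n0: "\<And>n. n \<ge> n0 \<Longrightarrow> N \<le> n \<and> s n < \<eta> \<and> \<phi> (s n) < \<sigma> * (\<epsilon> / 2)"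
    by (auto simp: eventually_sequentially)
  obtain t where t: "strict_mono t" "(z \<circ> t) \<longlonglongrightarrow> xbar"
    using acc by (auto simp: accumulation_point_def)
  obtain m where m: "\<And>n. n \<ge> m \<Longrightarrow> norm (z (t n) - xbar) < \<epsilon> / 2"
    using LIMSEQ_D[OF t(2), of "\<epsilon> / 2"] \<epsilon> by auto
  define k where "k = t (max m n0)"
  have "k \<ge> n0" using seq_suble[OF t(1), of "max m n0"] by (simp add: k_def)
  then have k: "N \<le> k" "\<phi> (s k) < \<sigma> * (\<epsilon> / 2)" "norm (z k - xbar) < \<epsilon> / 2"
    and small: "\<And>n. k \<le> n \<Longrightarrow> s n < \<eta>"
    using n0 m[of "max m n0"] by (auto simp: k_def)
  have near: "norm (z j - xbar) < \<epsilon>" if "k \<le> j" for j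
    using that
  proof (induction j rule: less_induct)
    case (less j)
    have "\<psi> (s n) \<le> w n" if "k \<le> n" "n < j" for n
      using less.IH[OF that(2,1)] that k \<epsilon> small[OF that(1)]
      by (intro KL) (auto simp: dist_norm norm_minus_commute)
    then have "\<sigma> * norm (z j - z k) \<le> \<phi> (s k) - \<phi> (s j)"
      using k(1) small less.prems descent pos
      by (intro descent_path_length[where w = w, OF des \<sigma>]) auto
    moreover have "\<phi> (s j) \<ge> 0"
      using des pos[of j] small[of j] less.prems k by (auto simp: desingularizing_def)
    ultimately have "\<sigma> * norm (z j - z k) < \<sigma> * (\<epsilon> / 2)" using k by linarith
    then have "norm (z j - z k) < \<epsilon> / 2" using \<sigma> by simp
    then show ?case using k(3) norm_triangle_ineq[of "z j - z k" "z k - xbar"] by simp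
  qed
  show "\<exists>no. \<forall>n\<ge>no. norm (z n - xbar) < e"
    using near \<epsilon>(2) by (intro exI[of _ k]) force
qed

text \<open>This transfers decay of the values to decay of the distance to the limit: let \<open>j\<close> tend to
  infinity in the length bound.\<close>

lemma descent_path_tail_bound:
  fixes z :: "nat \<Rightarrow> 'a::real_normed_vector"
  assumes des: "desingularizing \<phi> \<psi> \<eta>" and \<sigma>: "\<sigma> > 0"
    and descent: "\<And>n. N \<le> n \<Longrightarrow> \<sigma> * w n * norm (z (Suc n) - z n) \<le> s n - s (Suc n)"
    and pos: "\<And>n. N \<le> n \<Longrightarrow> 0 < s n"
    and KL: "\<And>n. N \<le> n \<Longrightarrow> s n < \<eta> \<and> \<psi> (s n) \<le> w n"
    and lim: "z \<longlonglongrightarrow> xbar" and "N \<le> k"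
  shows "norm (z k - xbar) \<le> \<phi> (s k) / \<sigma>"
proof -
  have norms: "(\<lambda>j. \<sigma> * norm (z j - z k)) \<longlonglongrightarrow> \<sigma> * norm (xbar - z k)"
    by (intro tendsto_intros lim)
  have "\<sigma> * norm (z j - z k) \<le> \<phi> (s k)" if "j \<ge> k" for j
  proof -
    have "\<sigma> * norm (z j - z k) \<le> \<phi> (s k) - \<phi> (s j)"
      using \<open>N \<le> k\<close> that KL descent pos
      by (intro descent_path_length[where w = w, OF des \<sigma>]) auto
    moreover have "\<phi> (s j) \<ge> 0"
      using des pos[of j] KL[of j] that \<open>N \<le> k\<close> by (auto simp: desingularizing_def)
    ultimately show ?thesis by linarith
  qed
  then have "\<sigma> * norm (xbar - z k) \<le> \<phi> (s k)"
    by (intro LIMSEQ_le_const2[OF norms]) blast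
  then show ?thesis using \<sigma> by (simp add: field_simps norm_minus_commute)
qed


section \<open>Rates for the recursion \<open>s (n + 1) \<le> s n - c * s n powr p\<close>\<close>

text \<open>Once \<open>s n \<le> 1\<close>, an exponent \<open>p \<le> 1\<close> gives \<open>s n powr p \<ge> s n\<close>.\<close>

lemma geometric_decay_if_exponent_le_1:
  fixes s :: "nat \<Rightarrow> real"
  assumes c: "c > 0" and p: "p \<le> 1"
    and pos: "\<And>n. N \<le> n \<Longrightarrow> 0 < s n" and le1: "\<And>n. N \<le> n \<Longrightarrow> s n \<le> 1"
    and rec: "\<And>n. N \<le> n \<Longrightarrow> c * s n powr p \<le> s n - s (Suc n)"
  obtains B \<rho> where "B > 0" "0 < \<rho>" "\<rho> < 1" "\<And>n. N \<le> n \<Longrightarrow> s n \<le> B * \<rho> ^ n"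
proof -
  \<comment> \<open>The maximum only serves to keep \<open>\<rho>\<close> positive.\<close>
  define \<rho> where "\<rho> = max (1 - c) (1 / 2)"
  have \<rho>: "0 < \<rho>" "\<rho> < 1" using c by (auto simp: \<rho>_def)
  have step: "s (Suc n) \<le> \<rho> * s n" if n: "N \<le> n" for n
  proof -
    have "s n powr 1 \<le> s n powr p" using pos[OF n] le1[OF n] p by (intro powr_mono') auto
    then have "c * s n \<le> c * s n powr p" using c pos[OF n] by simp
    then have "s (Suc n) \<le> (1 - c) * s n" using rec[OF n] by (simp add: algebra_simps)
    also have "\<dots> \<le> \<rho> * s n" using pos[OF n] by (intro mult_right_mono) (auto simp: \<rho>_def)
    finally show ?thesis .
  qed
  have "s n \<le> s N / \<rho> ^ N * \<rho> ^ n" if "N \<le> n" for n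
    using that
  proof (induction n rule: dec_induct)
    case (step n)
    have "s (Suc n) \<le> \<rho> * s n" using step by (intro \<open>\<And>n. N \<le> n \<Longrightarrow> s (Suc n) \<le> \<rho> * s n\<close>)
    also have "\<dots> \<le> \<rho> * (s N / \<rho> ^ N * \<rho> ^ n)" using step \<rho> by (intro mult_left_mono) auto
    finally show ?case by (simp add: mult_ac)
  qed (use \<rho> in simp)
  moreover have "s N / \<rho> ^ N > 0" using pos \<rho> by simp
  ultimately show ?thesis using that \<rho> by blast
qed

text \<open>This is the tangent inequality at \<open>a\<close> for the convex function \<open>t \<mapsto> t powr (- m)\<close>.\<close>

lemma powr_minus_tangent:
  fixes a b m :: real
  assumes "0 < a" "0 < b" "m > 0"
  shows "a powr (- m) + m * a powr (- m - 1) * (a - b) \<le> b powr (- m)"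
proof -
  have "ln (b / a) \<le> b / a - 1" using assms by (intro ln_le_minus_one) auto
  then have "m * ln (b / a) \<le> m * (b / a - 1)" using assms by (intro mult_left_mono) auto
  then have "1 + m * (1 - b / a) \<le> 1 + (- m * ln (b / a))" by (simp add: algebra_simps)
  also have "\<dots> \<le> exp (- m * ln (b / a))" by (rule exp_ge_add_one_self)
  also have "\<dots> = (b / a) powr (- m)" using assms by (simp add: powr_def)
  finally have "a powr (- m) * (1 + m * (1 - b / a)) \<le> a powr (- m) * (b / a) powr (- m)"
    by (intro mult_left_mono) auto
  also have "\<dots> = b powr (- m)" using assms by (simp add: powr_mult[symmetric])
  finally show ?thesis
    using assms by (simp add: powr_diff field_simps)
qed

text \<open>With \<open>m = p - 1\<close>, the tangent inequality turns the recursion into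
  \<open>s (n + 1) powr (- m) \<ge> s n powr (- m) + m * c\<close>, so \<open>s n powr (- m)\<close> grows at least linearly.\<close>

lemma polynomial_decay_if_exponent_gt_1:
  fixes s :: "nat \<Rightarrow> real"
  assumes c: "c > 0" and p: "p > 1"
    and pos: "\<And>n. N \<le> n \<Longrightarrow> 0 < s n"
    and rec: "\<And>n. N \<le> n \<Longrightarrow> c * s n powr p \<le> s n - s (Suc n)"
  obtains B N' where "B > 0" "N \<le> N'" "\<And>n. N' \<le> n \<Longrightarrow> s n \<le> B * real n powr (- (1 / (p - 1)))"
proof -
  define m where "m = p - 1"
  have m: "m > 0" using p by (simp add: m_def)
  have step: "s n powr (- m) + m * c \<le> s (Suc n) powr (- m)" if n: "N \<le> n" for n
  proof -
    have "s n powr (- m - 1) * (c * s n powr p) \<le> s n powr (- m - 1) * (s n - s (Suc n))"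
      using rec[OF n] by (intro mult_left_mono) auto
    moreover have "s n powr (- m - 1) * s n powr p = 1"
      using pos[OF n] by (simp add: powr_add[symmetric] m_def)
    ultimately have "c \<le> s n powr (- m - 1) * (s n - s (Suc n))"
      by (simp add: mult.left_commute)
    then have "m * c \<le> m * s n powr (- m - 1) * (s n - s (Suc n))"
      using m by (simp add: mult.assoc)
    then show ?thesis
      using powr_minus_tangent[of "s n" "s (Suc n)" m] pos[OF n] pos[of "Suc n"] n m by linarith
  qed
  have lin: "m * c * (real n - real N) \<le> s n powr (- m)" if "N \<le> n" for n
    using that
  proof (induction n rule: dec_induct)
    case (step n)
    then show ?case
      using \<open>\<And>n. N \<le> n \<Longrightarrow> s n powr (- m) + m * c \<le> s (Suc n) powr (- m)\<close>[of n]
      by (simp add: algebra_simps)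
  qed simp
  define b where "b = m * c / 2"
  have b: "b > 0" using m c by (simp add: b_def)
  \<comment> \<open>From \<open>2 * N\<close> on, \<open>n - N\<close> is at least \<open>n / 2\<close>; adding 1 makes \<open>n\<close> positive, because
    \<open>0 powr (- (1 / m)) = 0\<close>.\<close>
  have "s n \<le> b powr (- (1 / m)) * real n powr (- (1 / m))" if n: "2 * N + 1 \<le> n" for n
  proof -
    have "b * real n \<le> m * c * (real n - real N)"
    proof -
      have "m * c * (real n / 2) \<le> m * c * (real n - real N)"
        using n m c by (intro mult_left_mono) auto
      then show ?thesis by (simp add: b_def)
    qed
    also have "\<dots> \<le> s n powr (- m)" using lin n by simp
    finally have "(s n powr (- m)) powr (- (1 / m)) \<le> (b * real n) powr (- (1 / m))"
      using b n m by (intro powr_mono2') auto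
    then show ?thesis
      using pos[of n] n m b by (simp add: powr_powr powr_mult)
  qed
  then show ?thesis
    using that[of "b powr (- (1 / m))" "2 * N + 1"] b by (simp add: m_def)
qed

lemma converges_linearlyI:
  assumes "0 \<le> B" "0 < \<rho>" "\<rho> < 1" "\<And>n. N \<le> n \<Longrightarrow> norm (z n - l) \<le> B * \<rho> ^ n"
  shows "converges_linearly z l"
proof -
  have "norm (z n - l) \<le> (B + 1) * \<rho> ^ n" if "N \<le> n" for n
    using assms(4)[OF that] assms(2) by (simp add: distrib_right add_increasing2)
  then show ?thesis
    unfolding converges_linearly_def using assms
    by (intro exI[of _ "B + 1"] conjI bexI[of _ \<rho>]) (auto simp: eventually_sequentially)
qed


section \<open>Limits of the values and convergence of the algorithm\<close>

text \<open>An eventually decreasing sequence \<open>v\<close> either tends to \<open>-\<infinity>\<close> or converges; in the second case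
  its decrements, which dominate \<open>w\<^sup>2\<close>, tend to \<open>0\<close>.\<close>

lemma descent_dichotomy:
  fixes v w :: "nat \<Rightarrow> real"
  assumes a: "a > 0" and descent: "\<And>k. N \<le> k \<Longrightarrow> a * (w k)\<^sup>2 \<le> v k - v (Suc k)"
    and unbounded: "\<not> filterlim v at_bot sequentially"
  obtains l where "v \<longlonglongrightarrow> l" "w \<longlonglongrightarrow> 0"
proof -
  define y where "y n = v (n + N)" for n
  have dec: "decseq y"
  proof (rule decseq_SucI)
    fix n
    have "0 \<le> a * (w (n + N))\<^sup>2" using a by simp
    then show "y (Suc n) \<le> y n" using descent[of "n + N"] by (simp add: y_def)
  qed
  have "\<exists>B. \<forall>n. B \<le> y n"
  proof (rule ccontr)
    assume neg: "\<nexists>B. \<forall>n. B \<le> y n"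
    have "filterlim v at_bot sequentially"
      unfolding filterlim_at_bot
    proof
      fix Z
      obtain n where n: "y n < Z" using neg by (meson not_le)
      have "v m \<le> Z" if "n + N \<le> m" for m
        using decseqD[OF dec, of n "m - N"] n that by (simp add: y_def le_diff_conv2)
      then show "\<forall>\<^sub>F m in sequentially. v m \<le> Z" by (auto simp: eventually_sequentially)
    qed
    then show False using unbounded by contradiction
  qed
  then obtain B where "\<forall>n. B \<le> y n" by blast
  then obtain l where "y \<longlonglongrightarrow> l" using decseq_convergent[OF dec] by blast
  then have l: "v \<longlonglongrightarrow> l" unfolding y_def by (rule LIMSEQ_offset)
  have "(\<lambda>k. v k - v (Suc k)) \<longlonglongrightarrow> l - l" by (intro tendsto_diff l LIMSEQ_Suc)
  then have "(\<lambda>k. (v k - v (Suc k)) / a) \<longlonglongrightarrow> 0" by (intro tendsto_divide_zero) simp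
  then have "(\<lambda>k. (w k)\<^sup>2) \<longlonglongrightarrow> 0"
  proof (rule Lim_null_comparison[rotated])
    show "\<forall>\<^sub>F k in sequentially. norm ((w k)\<^sup>2) \<le> (v k - v (Suc k)) / a"
      using descent a by (auto simp: eventually_sequentially field_simps)
  qed
  then have "(\<lambda>k. sqrt ((w k)\<^sup>2)) \<longlonglongrightarrow> sqrt 0" by (rule tendsto_real_sqrt)
  then have "(\<lambda>k. \<bar>w k\<bar>) \<longlonglongrightarrow> 0" by simp
  then have "w \<longlonglongrightarrow> 0" by (rule tendsto_rabs_zero_cancel)
  with l show ?thesis by (rule that)
qed

text \<open>A strictly decreasing sequence of values stays strictly above its limit, which is the value at
  any accumulation point by continuity.\<close>

lemma values_above_accumulation_value:
  fixes f :: "'a::topological_space \<Rightarrow> real"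
  assumes cont: "continuous_on UNIV f" and lim: "(\<lambda>k. f (x k)) \<longlonglongrightarrow> l"
    and dec: "\<And>k. N \<le> k \<Longrightarrow> f (x (Suc k)) < f (x k)"
    and acc: "accumulation_point x xbar"
  shows "(\<lambda>k. f (x k)) \<longlonglongrightarrow> f xbar" "\<And>k. N \<le> k \<Longrightarrow> f xbar < f (x k)"
proof -
  obtain t where t: "strict_mono t" "(x \<circ> t) \<longlonglongrightarrow> xbar"
    using acc by (auto simp: accumulation_point_def)
  have "(\<lambda>n. f ((x \<circ> t) n)) \<longlonglongrightarrow> f xbar"
    by (rule continuous_on_tendsto_compose[OF cont t(2)]) auto
  moreover have "(\<lambda>n. f ((x \<circ> t) n)) \<longlonglongrightarrow> l"
    using LIMSEQ_subseq_LIMSEQ[OF lim t(1)] by (simp add: o_def)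
  ultimately have "l = f xbar" using LIMSEQ_unique by blast
  with lim show l': "(\<lambda>k. f (x k)) \<longlonglongrightarrow> f xbar" by simp
  fix k assume k: "N \<le> k"
  have "f (x j) \<le> f (x (Suc k))" if "Suc k \<le> j" for j
    using that
  proof (induction j rule: dec_induct)
    case (step n)
    then show ?case using dec[of n] k by simp
  qed simp
  then have "f xbar \<le> f (x (Suc k))"
    by (intro tendsto_upperbound[OF l']) (auto simp: eventually_sequentially)
  then show "f xbar < f (x k)" using dec[OF k] by simp
qed

theorem theorem4p3:
  fixes f :: "real ^ 'n \<Rightarrow> real"
    and G :: "real ^ 'n \<Rightarrow> real \<Rightarrow> real ^ 'n"
    and L \<theta> \<mu> r \<kappa> :: real
    and x g :: "nat \<Rightarrow> real ^ 'n"
    and i :: "nat \<Rightarrow> nat"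
    and \<delta> C :: "nat \<Rightarrow> real"
  assumes "C1_smooth f"
    and "L > 0"
    and "L-lipschitz_on UNIV (gradient f)"
    and "DFC_run f G \<theta> \<mu> r \<kappa> x g i \<delta> C"
    and "\<forall>k\<ge>1. gradient f (x k) \<noteq> 0"
  shows "filterlim (\<lambda>k. f (x k)) at_bot sequentially \<or>
    ((\<lambda>k. gradient f (x k)) \<longlonglongrightarrow> 0 \<and>
     (\<forall>xbar. accumulation_point x xbar \<and> KL_property f xbar \<longrightarrow> x \<longlonglongrightarrow> xbar) \<and>
     (\<forall>xbar M q. accumulation_point x xbar \<and> M > 0 \<and> 0 < q \<and> q < 1 \<and>
          KL_property_with f xbar (\<lambda>t. M * t powr q) \<longrightarrow>
        (q \<le> 1/2 \<longrightarrow>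
           converges_linearly x xbar \<and>
           converges_linearly (\<lambda>k. gradient f (x k)) 0 \<and>
           converges_linearly (\<lambda>k. f (x k)) (f xbar)) \<and>
        (1/2 < q \<longrightarrow>
           (\<lambda>k. norm (x k - xbar)) \<in> O(\<lambda>k. real k powr (- ((1 - q) / (2 * q - 1)))) \<and>
           (\<lambda>k. norm (gradient f (x k))) \<in> O(\<lambda>k. real k powr (- ((1 - q) / (2 * q - 1)))) \<and>
           (\<lambda>k. f (x k) - f xbar) \<in> O(\<lambda>k. real k powr (- ((2 - 2 * q) / (2 * q - 1)))))))"
proof (cases "filterlim (\<lambda>k. f (x k)) at_bot sequentially")
  case True
  then show ?thesis by (rule disjI1)
next
  case bd: False
  have diff: "f differentiable (at y)" for y using assms(1) by (simp add: C1_smooth_def)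
  have cont: "continuous_on UNIV f"
    using diff by (simp add: continuous_on_eq_continuous_at differentiable_imp_continuous_within)
  have gcont: "continuous_on UNIV (gradient f)" using assms(1) by (simp add: C1_smooth_def)
  define w where "w k = norm (gradient f (x k))" for k
  obtain N a \<sigma> where N: "N \<ge> 1" and a: "a > 0" and \<sigma>: "\<sigma> > 0"
    and desc: "\<And>k. k \<ge> N \<Longrightarrow> a * (w k)\<^sup>2 \<le> f (x k) - f (x (Suc k))"
    and sdesc: "\<And>k. k \<ge> N \<Longrightarrow> \<sigma> * w k * norm (x (Suc k) - x k) \<le> f (x k) - f (x (Suc k))"
    unfolding w_def using DFC_eventual_descent[OF diff assms(3,4)] by metis
  obtain l where l: "(\<lambda>k. f (x k)) \<longlonglongrightarrow> l" and w0: "w \<longlonglongrightarrow> 0"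
    using descent_dichotomy[OF a desc bd] by blast
  have grad0: "(\<lambda>k. gradient f (x k)) \<longlonglongrightarrow> 0"
    using w0 unfolding w_def by (rule tendsto_norm_zero_cancel)
  have dec: "f (x (Suc k)) < f (x k)" if "k \<ge> N" for k
  proof -
    have "0 < a * (w k)\<^sup>2" using assms(5) N that a by (simp add: w_def)
    then show ?thesis using desc[OF that] by linarith
  qed
  have conv: "x \<longlonglongrightarrow> xbar" if acc: "accumulation_point x xbar" and KL: "KL_property f xbar" for xbar
  proof -
    have vals: "(\<lambda>k. f (x k)) \<longlonglongrightarrow> f xbar" "\<And>k. N \<le> k \<Longrightarrow> f xbar < f (x k)"
      using values_above_accumulation_value[OF cont l _ acc] dec by blast+
    define s where "s k = f (x k) - f xbar" for k
    obtain \<psi> \<eta> U where \<eta>: "\<eta> > 0" and U: "xbar \<in> interior U"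
      and \<psi>: "mono_on {0<..<\<eta>} \<psi>" "\<forall>t\<in>{0<..<\<eta>}. \<psi> t > 0"
        "set_integrable lborel {0<..<\<eta>} (\<lambda>t. 1 / \<psi> t)"
      and ineq: "\<forall>y\<in>U. f xbar < f y \<and> f y < f xbar + \<eta> \<longrightarrow>
           norm (gradient f y) \<ge> \<psi> (f y - f xbar)"
      using KL unfolding KL_property_def KL_property_with_def by blast
    obtain \<phi> where "desingularizing \<phi> \<psi> \<eta>" using desingularizing_integral[OF \<eta> \<psi>(1)] \<psi> by blast
    then show ?thesis
    proof (rule descent_path_tendsto[OF _ \<eta> \<sigma>])
      show "\<And>n. N \<le> n \<Longrightarrow> \<sigma> * w n * norm (x (Suc n) - x n) \<le> s n - s (Suc n)"
        using sdesc by (simp add: s_def)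
      show "\<And>n. N \<le> n \<Longrightarrow> 0 < s n" using vals(2) by (simp add: s_def)
      show "s \<longlonglongrightarrow> 0" unfolding s_def using vals(1) by (simp add: LIM_zero)
      show "\<And>n. N \<le> n \<Longrightarrow> x n \<in> U \<Longrightarrow> s n < \<eta> \<Longrightarrow> \<psi> (s n) \<le> w n"
        using ineq vals(2) by (simp add: s_def w_def)
    qed fact+
  qed
  have rates: "(q \<le> 1/2 \<longrightarrow>
           converges_linearly x xbar \<and>
           converges_linearly (\<lambda>k. gradient f (x k)) 0 \<and>
           converges_linearly (\<lambda>k. f (x k)) (f xbar)) \<and>
        (1/2 < q \<longrightarrow>
           (\<lambda>k. norm (x k - xbar)) \<in> O(\<lambda>k. real k powr (- ((1 - q) / (2 * q - 1)))) \<and>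
           (\<lambda>k. norm (gradient f (x k))) \<in> O(\<lambda>k. real k powr (- ((1 - q) / (2 * q - 1)))) \<and>
           (\<lambda>k. f (x k) - f xbar) \<in> O(\<lambda>k. real k powr (- ((2 - 2 * q) / (2 * q - 1)))))"
    if acc: "accumulation_point x xbar" and M: "M > 0" and q: "0 < q" "q < 1"
      and KL: "KL_property_with f xbar (\<lambda>t. M * t powr q)" for xbar M q
  proof -
    have vals: "(\<lambda>k. f (x k)) \<longlonglongrightarrow> f xbar" "\<And>k. N \<le> k \<Longrightarrow> f xbar < f (x k)"
      using values_above_accumulation_value[OF cont l _ acc] dec by blast+
    define s where "s k = f (x k) - f xbar" for k
    define D where "D = 1 / (M * (1 - q)) / \<sigma>"
    have D: "D > 0" using M q \<sigma> by (simp add: D_def)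
    have lim: "x \<longlonglongrightarrow> xbar" using conv[OF acc] KL unfolding KL_property_def by blast
    have spos: "0 < s n" if "N \<le> n" for n using vals(2)[OF that] by (simp add: s_def)
    have s0: "s \<longlonglongrightarrow> 0" unfolding s_def using vals(1) by (simp add: LIM_zero)
    have "(\<lambda>k. gradient f (x k)) \<longlonglongrightarrow> gradient f xbar"
      by (rule continuous_on_tendsto_compose[OF gcont lim]) auto
    then have "gradient f xbar = 0" using grad0 LIMSEQ_unique by blast
    then have grad: "w k \<le> L * norm (x k - xbar)" for k
      using lipschitz_onD[OF assms(3), of "x k" xbar] by (simp add: w_def dist_norm)
    obtain \<eta> U where \<eta>: "\<eta> > 0" and U: "xbar \<in> interior U"
      and ineq: "\<forall>y\<in>U. f xbar < f y \<and> f y < f xbar + \<eta> \<longrightarrow>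
           norm (gradient f y) \<ge> M * (f y - f xbar) powr q"
      using KL unfolding KL_property_with_def by blast
    have "\<forall>\<^sub>F k in sequentially. x k \<in> interior U \<and> s k < \<eta> \<and> s k < 1 \<and> N \<le> k"
      using topological_tendstoD[OF lim open_interior U] order_tendstoD(2)[OF s0, of \<eta>]
        order_tendstoD(2)[OF s0, of 1] \<eta>
      by (auto intro!: eventually_conj eventually_ge_at_top)
    then obtain m where m: "\<And>k. m \<le> k \<Longrightarrow> x k \<in> interior U \<and> s k < \<eta> \<and> s k < 1 \<and> N \<le> k"
      by (auto simp: eventually_sequentially)
    have KLm: "M * s k powr q \<le> w k" if "m \<le> k" for k
      using ineq m[OF that] spos[of k] interior_subset[of U] by (auto simp: s_def w_def)
    have xbound: "norm (x k - xbar) \<le> D * s k powr (1 - q)" if "m \<le> k" for k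
    proof -
      have "norm (x k - xbar) \<le> (s k powr (1 - q) / (M * (1 - q))) / \<sigma>"
        by (rule descent_path_tail_bound[OF desingularizing_powr[OF M q] \<sigma> _ _ _ lim that,
              where w = w and \<eta> = \<eta>])
          (use m spos KLm sdesc in \<open>auto simp: s_def\<close>)
      then show ?thesis by (simp add: D_def)
    qed
    have gbound: "w k \<le> L * D * s k powr (1 - q)" if "m \<le> k" for k
      using order_trans[OF grad mult_left_mono[OF xbound[OF that], of L]] assms(2)
      by (simp add: mult.assoc)
    define c where "c = a * M\<^sup>2"
    have c: "c > 0" using a M by (simp add: c_def)
    have rec: "c * s k powr (2 * q) \<le> s k - s (Suc k)" if "m \<le> k" for k
    proof -
      have "(M * s k powr q)\<^sup>2 \<le> (w k)\<^sup>2" using KLm[OF that] M by (intro power_mono) auto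
      then have "a * (M * s k powr q)\<^sup>2 \<le> a * (w k)\<^sup>2" using a by simp
      also have "\<dots> \<le> s k - s (Suc k)" using desc[of k] m[OF that] by (simp add: s_def)
      finally have "a * (M\<^sup>2 * (s k powr q)\<^sup>2) \<le> s k - s (Suc k)"
        by (simp add: power_mult_distrib)
      moreover have "(s k powr q)\<^sup>2 = s k powr (2 * q)"
        by (simp add: power2_eq_square powr_add[symmetric])
      ultimately show ?thesis by (simp add: c_def mult.assoc)
    qed
    have sposm: "0 < s k" if "m \<le> k" for k using spos m[OF that] by simp
    show ?thesis
    proof (intro conjI impI)
      assume q2: "q \<le> 1/2"
      obtain B \<rho> where B: "B > 0" and \<rho>: "0 < \<rho>" "\<rho> < 1"
        and sB: "\<And>n. m \<le> n \<Longrightarrow> s n \<le> B * \<rho> ^ n"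
      proof (rule geometric_decay_if_exponent_le_1[of c "2 * q" m s])
        show "2 * q \<le> 1" using q2 by simp
        show "s n \<le> 1" if "m \<le> n" for n using m[OF that] by simp
        show "0 < s n" if "m \<le> n" for n using that by (rule sposm)
        show "c * s n powr (2 * q) \<le> s n - s (Suc n)" if "m \<le> n" for n using that by (rule rec)
      qed (rule c, rule that)
      define \<rho>' where "\<rho>' = \<rho> powr (1 - q)"
      have \<rho>': "0 < \<rho>'" "\<rho>' < 1"
        using \<rho> q powr_less_mono'[of \<rho> 0 "1 - q"] by (auto simp: \<rho>'_def)
      have sq: "s n powr (1 - q) \<le> B powr (1 - q) * \<rho>' ^ n" if "m \<le> n" for n
      proof -
        have "s n powr (1 - q) \<le> (B * \<rho> ^ n) powr (1 - q)"
          using sB[OF that] sposm[OF that] q by (intro powr_mono2) auto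
        also have "\<dots> = B powr (1 - q) * \<rho>' ^ n"
          using B \<rho> by (simp add: \<rho>'_def powr_mult powr_realpow[symmetric] powr_powr mult.commute)
        finally show ?thesis .
      qed
      show "converges_linearly x xbar"
      proof (rule converges_linearlyI[OF _ \<rho>'])
        show "norm (x n - xbar) \<le> (D * B powr (1 - q)) * \<rho>' ^ n" if "m \<le> n" for n
          using order_trans[OF xbound[OF that] mult_left_mono[OF sq[OF that], of D]] D
          by (simp add: mult.assoc)
      qed (use D in simp)
      show "converges_linearly (\<lambda>k. gradient f (x k)) 0"
      proof (rule converges_linearlyI[OF _ \<rho>'])
        show "norm (gradient f (x n) - 0) \<le> (L * D * B powr (1 - q)) * \<rho>' ^ n" if "m \<le> n" for n
          using order_trans[OF gbound[OF that] mult_left_mono[OF sq[OF that], of "L * D"]]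
            D assms(2)
          by (simp add: w_def mult.assoc)
      qed (use D assms(2) in simp)
      show "converges_linearly (\<lambda>k. f (x k)) (f xbar)"
      proof (rule converges_linearlyI[OF _ \<rho>])
        show "norm (f (x n) - f xbar) \<le> B * \<rho> ^ n" if "m \<le> n" for n
          using sB[OF that] sposm[OF that] by (simp add: s_def)
      qed (use B in simp)
    next
      assume q2: "1/2 < q"
      obtain B m' where B: "B > 0" and m': "m \<le> m'"
        and sB: "\<And>n. m' \<le> n \<Longrightarrow> s n \<le> B * real n powr (- (1 / (2 * q - 1)))"
      proof (rule polynomial_decay_if_exponent_gt_1[of c "2 * q" m s])
        show "2 * q > 1" using q2 by simp
        show "0 < s n" if "m \<le> n" for n using that by (rule sposm)
        show "c * s n powr (2 * q) \<le> s n - s (Suc n)" if "m \<le> n" for n using that by (rule rec)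
      qed (rule c, rule that)
      have sq: "s n powr (1 - q) \<le> B powr (1 - q) * real n powr (- ((1 - q) / (2 * q - 1)))"
        if n: "m' \<le> n" for n
      proof -
        have "s n powr (1 - q) \<le> (B * real n powr (- (1 / (2 * q - 1)))) powr (1 - q)"
          using sB[OF n] sposm[of n] n m' q by (intro powr_mono2) auto
        also have "\<dots> = B powr (1 - q) * real n powr (- ((1 - q) / (2 * q - 1)))"
          using B by (simp add: powr_mult powr_powr)
        finally show ?thesis .
      qed
      show "(\<lambda>k. norm (x k - xbar)) \<in> O(\<lambda>k. real k powr (- ((1 - q) / (2 * q - 1))))"
      proof (rule bigoI)
        have "norm (x n - xbar) \<le> D * B powr (1 - q) * real n powr (- ((1 - q) / (2 * q - 1)))"
          if "m' \<le> n" for n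
          using order_trans[OF xbound[of n] mult_left_mono[OF sq[OF that], of D]] D that m'
          by (simp add: mult.assoc)
        then show "\<forall>\<^sub>F n in sequentially. norm (norm (x n - xbar))
            \<le> D * B powr (1 - q) * norm (real n powr (- ((1 - q) / (2 * q - 1))))"
          by (auto simp: eventually_sequentially)
      qed
      show "(\<lambda>k. norm (gradient f (x k))) \<in> O(\<lambda>k. real k powr (- ((1 - q) / (2 * q - 1))))"
      proof (rule bigoI)
        have "w n \<le> L * D * B powr (1 - q) * real n powr (- ((1 - q) / (2 * q - 1)))"
          if "m' \<le> n" for n
          using order_trans[OF gbound[of n] mult_left_mono[OF sq[OF that], of "L * D"]]
            D assms(2) that m'
          by (simp add: mult.assoc)
        then show "\<forall>\<^sub>F n in sequentially. norm (norm (gradient f (x n)))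
            \<le> L * D * B powr (1 - q) * norm (real n powr (- ((1 - q) / (2 * q - 1))))"
          by (auto simp: eventually_sequentially w_def)
      qed
      \<comment> \<open>The values decay even like \<open>k powr (- (1 / (2 * q - 1)))\<close>, and \<open>2 - 2 * q < 1\<close>.\<close>
      show "(\<lambda>k. f (x k) - f xbar) \<in> O(\<lambda>k. real k powr (- ((2 - 2 * q) / (2 * q - 1))))"
      proof (rule bigoI)
        have "norm (f (x n) - f xbar) \<le> B * norm (real n powr (- ((2 - 2 * q) / (2 * q - 1))))"
          if n: "m' \<le> n" for n
        proof -
          have "n \<ge> 1" using n m' m[of n] N by simp
          then have "real n powr (- (1 / (2 * q - 1))) \<le> real n powr (- ((2 - 2 * q) / (2 * q - 1)))"
            using q2 by (intro powr_mono) (auto simp: divide_simps)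
          then have "B * real n powr (- (1 / (2 * q - 1)))
              \<le> B * real n powr (- ((2 - 2 * q) / (2 * q - 1)))" using B by simp
          then show ?thesis using sB[OF n] sposm[of n] n m' by (simp add: s_def)
        qed
        then show "\<forall>\<^sub>F n in sequentially. norm (f (x n) - f xbar)
            \<le> B * norm (real n powr (- ((2 - 2 * q) / (2 * q - 1))))"
          by (auto simp: eventually_sequentially)
      qed
    qed
  qed
  show ?thesis using grad0 conv rates by blast
qed

end
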